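(* For every integer $k\ge 0$, $D_k$ is the family of graphs locally derivable by $D_{k-1}$, i.e. $\bigtriangleup(D_{k-1})=D_k$.
   Context: All graphs are finite, undirected, without loops or multiple edges, with at least one vertex, and families of graphs are considered up to isomorphism (closed under isomorphism). For a graph $X$ and a vertex $x$, $N_X(x)$ is the set of neighbours of $x$, identified with the subgraph of $X$ it induces, $N_X[x]=N_X(x)\cup\{x\}$, and $X-x$ is the subgraph induced by $V(X)\setminus\{x\}$. A graph $X$ is a cone if it has a vertex $x$ with $N_X[x]=V(X)$; the one-vertex graph $pt$ is a cone. Let $D_{-1}$ be the class of cones. Inductively, for an integer $k\ge 0$: a vertex $x$ of $X$ is $k$-dismantlable if $N_X(x)$ is non-empty and the graph $N_X(x)$ belongs to $D_{k-1}$; a graph is $k$-dismantlable if it can be reduced to a single vertex by successively deleting vertices, each being $k$-dismantlable in the current graph; $D_k$ is the class of $k$-dismantlable graphs. For a family $\mathcal R$ of non-empty graphs, $\bigtriangleup(\mathcal R)$, the family of graphs locally derivable by $\mathcal R$, is the smallest family of graphs which contains the one-vertex graph $pt$ and satisfies: for every graph $X$ and vertex $x$ of $X$, if $X-x\in\bigtriangleup(\mathcal R)$ and $N_X(x)\in\mathcal R$, then $X\in\bigtriangleup(\mathcal R)$. *)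

theory Defs
  imports "Graph_Theory.Digraph_Isomorphism"
begin

text \<open>
  The locale \<^locale>\<open>graph\<close> describes finite, symmetric, loop-free digraphs without parallel
  arcs, i.e. finite simple undirected graphs (an edge is a pair of opposite arcs). It admits
  the graph without vertices, which is excluded here.
\<close>

definition nonempty_graph :: "('a, 'b) pre_digraph \<Rightarrow> bool" where
  "nonempty_graph X \<longleftrightarrow> graph X \<and> verts X \<noteq> {}"

definition single_vertex_graph :: "('a, 'b) pre_digraph \<Rightarrow> bool" where
  "single_vertex_graph X \<longleftrightarrow> graph X \<and> card (verts X) = 1"

definition nbrs :: "('a, 'b) pre_digraph \<Rightarrow> 'a \<Rightarrow> 'a set" where
  "nbrs X x = {y. x \<rightarrow>\<^bsub>X\<^esub> y}"

definition nbr_graph :: "('a, 'b) pre_digraph \<Rightarrow> 'a \<Rightarrow> ('a, 'b) pre_digraph" where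
  "nbr_graph X x = X \<restriction> nbrs X x"

definition delete_vertex :: "('a, 'b) pre_digraph \<Rightarrow> 'a \<Rightarrow> ('a, 'b) pre_digraph" where
  "delete_vertex X x = X \<restriction> (verts X - {x})"

definition cone :: "('a, 'b) pre_digraph \<Rightarrow> bool" where
  "cone X \<longleftrightarrow> nonempty_graph X \<and> (\<exists>x \<in> verts X. insert x (nbrs X x) = verts X)"

text \<open>
  Parametrised by a family \<open>C\<close> of graphs; a \<open>k\<close>-dismantlable vertex is the case where \<open>C\<close> is
  the class of \<open>(k - 1)\<close>-dismantlable graphs.
\<close>

definition dismantlable_vertex ::
    "('a, 'b) pre_digraph set \<Rightarrow> ('a, 'b) pre_digraph \<Rightarrow> 'a \<Rightarrow> bool" where
  "dismantlable_vertex C X x \<longleftrightarrow> x \<in> verts X \<and> nbrs X x \<noteq> {} \<and> nbr_graph X x \<in> C"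

definition dismantle_step ::
    "('a, 'b) pre_digraph set \<Rightarrow> ('a, 'b) pre_digraph \<Rightarrow> ('a, 'b) pre_digraph \<Rightarrow> bool" where
  "dismantle_step C X Y \<longleftrightarrow> (\<exists>x. dismantlable_vertex C X x \<and> Y = delete_vertex X x)"

text \<open>
  \<open>dismantlable k\<close> is the class \<open>D\<^sub>k\<close>, for integers \<open>k \<ge> -1\<close>. The value for \<open>k < -1\<close> has no
  meaning.
\<close>

function dismantlable :: "int \<Rightarrow> ('a, 'b) pre_digraph set" where
  "dismantlable k =
    (if k < 0 then {X. cone X}
     else {X. nonempty_graph X \<and>
              (\<exists>P. single_vertex_graph P \<and> (dismantle_step (dismantlable (k - 1)))\<^sup>*\<^sup>* X P)})"
  by auto
termination
  by (relation "measure (\<lambda>k. nat (k + 1))") auto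

declare dismantlable.simps [simp del]

lemma dismantlable_minus_one: "dismantlable (-1) = {X. cone X}"
  by (simp add: dismantlable.simps)

lemma dismantlable_nonneg:
  assumes "0 \<le> k"
  shows "dismantlable k = {X. nonempty_graph X \<and>
    (\<exists>P. single_vertex_graph P \<and> (dismantle_step (dismantlable (k - 1)))\<^sup>*\<^sup>* X P)}"
  using assms by (subst dismantlable.simps) simp

text \<open>
  Families of graphs are closed under isomorphism, so the smallest family is taken among
  isomorphism-closed ones; the base case admits every representative of the one-vertex graph.
\<close>

inductive_set locally_derivable ::
    "('a, 'b) pre_digraph set \<Rightarrow> ('a, 'b) pre_digraph set" (\<open>\<triangle>\<close>)
  for R :: "('a, 'b) pre_digraph set" where
  pt: "single_vertex_graph X \<Longrightarrow> X \<in> \<triangle> R"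
| iso: "X \<in> \<triangle> R \<Longrightarrow> digraph_iso X Y \<Longrightarrow> Y \<in> \<triangle> R"
| extend: "nonempty_graph X \<Longrightarrow> x \<in> verts X \<Longrightarrow> delete_vertex X x \<in> \<triangle> R \<Longrightarrow> nbr_graph X x \<in> R \<Longrightarrow>
    X \<in> \<triangle> R"

end

theory Submission
  imports Defs
begin

text \<open>
  Both families are built by adding a vertex whose neighbourhood lies in \<open>C = D\<^bsub>k-1\<^esub>\<close>: the
  locally derivable graphs are generated upwards from a point, and a dismantling is such a
  construction read backwards. A dismantlable vertex must moreover have a neighbour. A vertex
  added in a local derivation has one, because the graphs in \<open>C\<close> are non-empty; in a dismantling
  the condition keeps the last vertex from being deleted.

  The two constructions still differ in that the locally derivable graphs are closed under
  isomorphism by definition, so closure has to be proved for \<open>D\<^sub>k\<close>. An isomorphism restricts to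
  the neighbourhood of a vertex and to its complement; hence if \<open>C\<close> is closed, a dismantling can
  be transported step by step (lemma \<open>dismantling_app_iso\<close>). Induction on \<open>k\<close> starting from the
  cones then gives the closure of every \<open>D\<^sub>k\<close> (lemma \<open>iso_closed_dismantlable\<close>). The comparison
  itself is carried out over an arbitrary isomorphism-closed family of non-empty graphs (lemma
  \<open>locally_derivable_eq_dismantlings\<close>).
\<close>

section \<open>Isomorphisms, neighbourhoods and vertex deletion\<close>

lemma graph_induce_subgraph:
  assumes "graph X" "S \<subseteq> verts X"
  shows "graph (X \<restriction> S)"
proof -
  interpret graph X by fact
  have induced: "induced_subgraph (X \<restriction> S) X" using assms(2) by (rule induced_induce)
  show ?thesis
    using digraphI_induced[OF induced] induced_graph_imp_symmetric[OF sym_arcs induced]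
    by (rule digraph.graphI)
qed

lemma graph_app_iso:
  assumes "graph X" and hom: "pre_digraph.digraph_isomorphism X f"
  shows "graph (app_iso f X)"
proof -
  interpret graph X by fact
  interpret Y: fin_digraph "app_iso f X" using hom by (rule fin_digraphI_app_iso)
  note ends = iso_verts_tail[OF hom] iso_verts_head[OF hom]
  show ?thesis
  proof
    fix e assume "e \<in> arcs (app_iso f X)"
    then show "tail (app_iso f X) e \<noteq> head (app_iso f X) e"
      using hom no_loops by (auto simp: ends)
  next
    fix e1 e2
    assume "e1 \<in> arcs (app_iso f X)" "e2 \<in> arcs (app_iso f X)"
      "arc_to_ends (app_iso f X) e1 = arc_to_ends (app_iso f X) e2"
    then show "e1 = e2"
      using hom no_multi_arcs by (auto simp: ends arc_to_ends_def)
  next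
    show "symmetric (app_iso f X)"
      using sym_arcs hom unfolding symmetric_def sym_def by (auto simp: arcs_ends_app_iso_eq)
  qed
qed

lemma nonempty_graph_app_iso:
  assumes "nonempty_graph X" "pre_digraph.digraph_isomorphism X f"
  shows "nonempty_graph (app_iso f X)"
  using assms by (simp add: nonempty_graph_def graph_app_iso)

lemma single_vertex_graph_app_iso:
  assumes "single_vertex_graph X" "pre_digraph.digraph_isomorphism X f"
  shows "single_vertex_graph (app_iso f X)"
  using assms by (simp add: single_vertex_graph_def graph_app_iso)

lemma digraph_isomorphism_induce:
  assumes "pre_digraph.digraph_isomorphism X f" "S \<subseteq> verts X"
  shows "pre_digraph.digraph_isomorphism (X \<restriction> S) f"
proof -
  have "wf_digraph X" using assms(1) by (simp add: pre_digraph.digraph_isomorphism_def)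
  then show ?thesis
    using assms pre_digraph.digraph_isomorphism_subgraphI wf_digraph.subgraph_induce_subgraphI
    by blast
qed

lemma app_iso_induce_subgraph:
  assumes hom: "pre_digraph.digraph_isomorphism X f" and S: "S \<subseteq> verts X"
  shows "app_iso f (X \<restriction> S) = app_iso f X \<restriction> (iso_verts f ` S)"
proof -
  interpret wf_digraph X using hom by (simp add: pre_digraph.digraph_isomorphism_def)
  have tail: "iso_tail f (iso_arcs f e) \<in> iso_verts f ` S \<longleftrightarrow> tail X e \<in> S"
    and head: "iso_head f (iso_arcs f e) \<in> iso_verts f ` S \<longleftrightarrow> head X e \<in> S"
    if "e \<in> arcs X" for e
    using inj_on_image_mem_iff[OF digraph_isomorphism_inj_on_verts[OF hom] _ S] that
    by (simp_all add: iso_verts_tail[OF hom] iso_verts_head[OF hom])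
  have "arcs (app_iso f (X \<restriction> S)) = arcs (app_iso f X \<restriction> (iso_verts f ` S))"
    unfolding app_iso_simps induce_subgraph_arcs using tail head by blast
  then show ?thesis
    by (intro pre_digraph.equality) simp_all
qed

lemma nbrs_subset_verts:
  assumes "graph X"
  shows "nbrs X x \<subseteq> verts X"
proof -
  interpret graph X by fact
  show ?thesis using adj_in_verts by (auto simp: nbrs_def)
qed

lemma nbrs_app_iso:
  assumes "graph X" and hom: "pre_digraph.digraph_isomorphism X f" and x: "x \<in> verts X"
  shows "nbrs (app_iso f X) (iso_verts f x) = iso_verts f ` nbrs X x"
proof -
  interpret graph X by fact
  have "u = x" if "iso_verts f u = iso_verts f x" "u \<rightarrow>\<^bsub>X\<^esub> v" for u v
    using that x adj_in_verts(1) iso_verts_eq_iff[OF hom] by blast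
  then show ?thesis
    unfolding nbrs_def arcs_ends_app_iso_eq[OF hom] by force
qed

lemma nbr_graph_app_iso:
  assumes "graph X" "pre_digraph.digraph_isomorphism X f" "x \<in> verts X"
  shows "nbr_graph (app_iso f X) (iso_verts f x) = app_iso f (nbr_graph X x)"
  using assms by (simp add: nbr_graph_def nbrs_app_iso app_iso_induce_subgraph nbrs_subset_verts)

lemma delete_vertex_app_iso:
  assumes "graph X" and hom: "pre_digraph.digraph_isomorphism X f" and "x \<in> verts X"
  shows "delete_vertex (app_iso f X) (iso_verts f x) = app_iso f (delete_vertex X x)"
proof -
  have "iso_verts f ` (verts X - {x}) = iso_verts f ` verts X - {iso_verts f x}"
    using inj_on_image_set_diff[OF pre_digraph.digraph_isomorphism_inj_on_verts[OF hom],
        of "verts X" "{x}"] assms by simp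
  then show ?thesis
    using hom by (simp add: delete_vertex_def app_iso_induce_subgraph)
qed

lemma cone_app_iso:
  assumes "cone X" and hom: "pre_digraph.digraph_isomorphism X f"
  shows "cone (app_iso f X)"
proof -
  obtain x where X: "nonempty_graph X" and x: "x \<in> verts X" "insert x (nbrs X x) = verts X"
    using assms(1) unfolding cone_def by blast
  have "graph X" using X by (simp add: nonempty_graph_def)
  then have "insert (iso_verts f x) (nbrs (app_iso f X) (iso_verts f x)) = verts (app_iso f X)"
    using x nbrs_app_iso[OF _ hom] by (metis image_insert verts_app_iso)
  then show ?thesis
    using x(1) nonempty_graph_app_iso[OF X hom] unfolding cone_def by auto
qed

section \<open>Transport of dismantlings along isomorphisms\<close>

definition iso_closed :: "('a, 'b) pre_digraph set \<Rightarrow> bool" where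
  "iso_closed C \<longleftrightarrow> (\<forall>X\<in>C. \<forall>Y. digraph_iso X Y \<longrightarrow> Y \<in> C)"

lemma iso_closed_app_iso:
  "iso_closed C \<Longrightarrow> X \<in> C \<Longrightarrow> pre_digraph.digraph_isomorphism X f \<Longrightarrow> app_iso f X \<in> C"
  unfolding iso_closed_def digraph_iso_def by blast

text \<open>
  The neighbour required of a dismantlable vertex survives its deletion, since a graph has no
  loops.
\<close>

lemma nonempty_graph_dismantle_step:
  assumes "nonempty_graph X" "dismantle_step C X Y"
  shows "nonempty_graph Y"
proof -
  have X: "graph X" using assms(1) by (simp add: nonempty_graph_def)
  then interpret graph X .
  obtain x y where x: "Y = delete_vertex X x" "y \<in> nbrs X x"
    using assms(2) unfolding dismantle_step_def dismantlable_vertex_def by blast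
  then have "y \<in> verts X - {x}"
    using nbrs_subset_verts[OF X] adj_not_same by (auto simp: nbrs_def)
  then show ?thesis
    using x(1) graph_induce_subgraph[OF X] by (auto simp: nonempty_graph_def delete_vertex_def)
qed

lemma dismantle_step_app_iso:
  fixes X Y :: "('a, 'b) pre_digraph"
  assumes C: "iso_closed C" and X: "nonempty_graph X"
    and hom: "pre_digraph.digraph_isomorphism X f" and step: "dismantle_step C X Y"
  shows "dismantle_step C (app_iso f X) (app_iso f Y)"
    and "pre_digraph.digraph_isomorphism Y f"
proof -
  have gX: "graph X" using X by (simp add: nonempty_graph_def)
  obtain x where x: "x \<in> verts X" "nbrs X x \<noteq> {}" "nbr_graph X x \<in> C" "Y = delete_vertex X x"
    using step unfolding dismantle_step_def dismantlable_vertex_def by blast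
  show "pre_digraph.digraph_isomorphism Y f"
    unfolding x(4) delete_vertex_def using hom by (rule digraph_isomorphism_induce) auto
  have "pre_digraph.digraph_isomorphism (nbr_graph X x) f"
    unfolding nbr_graph_def using hom nbrs_subset_verts[OF gX] by (rule digraph_isomorphism_induce)
  then have "nbr_graph (app_iso f X) (iso_verts f x) \<in> C"
    using iso_closed_app_iso[OF C x(3)] nbr_graph_app_iso[OF gX hom x(1)] by simp
  then have "dismantlable_vertex C (app_iso f X) (iso_verts f x)"
    using x nbrs_app_iso[OF gX hom x(1)] by (auto simp: dismantlable_vertex_def)
  then show "dismantle_step C (app_iso f X) (app_iso f Y)"
    unfolding dismantle_step_def x(4) using delete_vertex_app_iso[OF gX hom x(1)] by metis
qed

text \<open>
  The maps of an isomorphism of \<open>X\<close> also serve for the subgraphs of \<open>X\<close>, so one \<open>f\<close> transports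
  the whole dismantling.
\<close>

lemma dismantling_app_iso:
  fixes X P :: "('a, 'b) pre_digraph"
  assumes C: "iso_closed C" and "(dismantle_step C)\<^sup>*\<^sup>* X P" "nonempty_graph X"
    "pre_digraph.digraph_isomorphism X f"
  shows "(dismantle_step C)\<^sup>*\<^sup>* (app_iso f X) (app_iso f P) \<and> pre_digraph.digraph_isomorphism P f"
  using assms(2-)
proof (induction rule: converse_rtranclp_induct)
  case base
  then show ?case by simp
next
  case (step X Y)
  then show ?case
    using dismantle_step_app_iso[OF C step.prems step.hyps(1)]
      nonempty_graph_dismantle_step[OF step.prems(1) step.hyps(1)]
    by (meson converse_rtranclp_into_rtranclp)
qed

lemma iso_closed_dismantlings:
  fixes C :: "('a, 'b) pre_digraph set"
  assumes "iso_closed C"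
  shows "iso_closed {X. nonempty_graph X \<and>
    (\<exists>P. single_vertex_graph P \<and> (dismantle_step C)\<^sup>*\<^sup>* X P)}"
  using dismantling_app_iso[OF assms] nonempty_graph_app_iso single_vertex_graph_app_iso
  unfolding iso_closed_def digraph_iso_def by blast

lemma iso_closed_dismantlable:
  assumes "-1 \<le> k"
  shows "iso_closed (dismantlable k :: ('a, 'b) pre_digraph set)"
  using assms
proof (induction rule: int_ge_induct)
  case base
  then show ?case
    using cone_app_iso unfolding dismantlable_minus_one iso_closed_def digraph_iso_def by blast
next
  case (step k)
  then show ?case
    using iso_closed_dismantlings[OF step.IH] by (simp add: dismantlable_nonneg)
qed

lemma nonempty_graph_dismantlable: "X \<in> dismantlable k \<Longrightarrow> nonempty_graph X"
  by (cases "k < 0") (simp_all add: dismantlable.simps[of k] cone_def)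

section \<open>Local derivations as reversed dismantlings\<close>

text \<open>
  From left to right, a derivation yields a dismantling in reverse order: the extension rule
  prepends a step, and the isomorphism rule transports the whole dismantling found so far, for
  which \<open>C\<close> must be closed. From right to left, isomorphisms do not occur, since a dismantling
  deletes vertices of one fixed graph.
\<close>

lemma locally_derivable_eq_dismantlings:
  fixes C :: "('a, 'b) pre_digraph set"
  assumes C: "iso_closed C" and nonempty: "\<And>X. X \<in> C \<Longrightarrow> nonempty_graph X"
  shows "\<triangle> C = {X. nonempty_graph X \<and>
    (\<exists>P. single_vertex_graph P \<and> (dismantle_step C)\<^sup>*\<^sup>* X P)}" (is "_ = ?D")
proof (intro set_eqI iffI)
  fix X assume "X \<in> \<triangle> C"
  then show "X \<in> ?D"
  proof induction
    case (pt X)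
    then have "nonempty_graph X" by (auto simp: single_vertex_graph_def nonempty_graph_def)
    with pt show ?case by blast
  next
    case (iso X Y)
    then show ?case using iso_closed_dismantlings[OF C] unfolding iso_closed_def by blast
  next
    case (extend X x)
    have "nbrs X x \<noteq> {}"
      using nonempty[OF extend.hyps(4)] by (simp add: nonempty_graph_def nbr_graph_def)
    then have "dismantle_step C X (delete_vertex X x)"
      using extend.hyps unfolding dismantle_step_def dismantlable_vertex_def by blast
    then show ?case
      using extend by (blast intro: converse_rtranclp_into_rtranclp)
  qed
next
  fix X assume "X \<in> ?D"
  then obtain P where "(dismantle_step C)\<^sup>*\<^sup>* X P" "nonempty_graph X" and P: "single_vertex_graph P"
    by blast
  then show "X \<in> \<triangle> C"
  proof (induction rule: converse_rtranclp_induct)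
    case base
    then show ?case by (simp add: locally_derivable.pt)
  next
    case (step X Y)
    then have "Y \<in> \<triangle> C" using nonempty_graph_dismantle_step by blast
    with step show ?case
      unfolding dismantle_step_def dismantlable_vertex_def
      by (auto intro: locally_derivable.extend)
  qed
qed

theorem proposition23:
  fixes k :: int
  assumes "0 \<le> k"
  shows "\<triangle> (dismantlable (k - 1)) = (dismantlable k :: ('a, 'b) pre_digraph set)"
proof -
  have "iso_closed (dismantlable (k - 1) :: ('a, 'b) pre_digraph set)"
    using assms by (intro iso_closed_dismantlable) simp
  then have "\<triangle> (dismantlable (k - 1) :: ('a, 'b) pre_digraph set) = {X. nonempty_graph X \<and>
      (\<exists>P. single_vertex_graph P \<and> (dismantle_step (dismantlable (k - 1)))\<^sup>*\<^sup>* X P)}"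
    using nonempty_graph_dismantlable by (rule locally_derivable_eq_dismantlings)
  then show ?thesis
    by (simp add: dismantlable_nonneg[OF assms])
qed

end
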